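(* Let $a_0\in\mathbb{R}$ be such that $a_0\not\equiv 0 \pmod{2\pi}$, and for $k\geq 0$ define $a_{k+1}=a_k+\sin a_k$. Then the sequence $(a_k)_{k\ge 0}$ converges and $$\lim_{k\rightarrow\infty} a_k\equiv \pi \pmod{2\pi}.$$
   Context: For $a,b,x\in\mathbb{R}$ with $x>0$, $a\equiv b\pmod{x}$ means that $a-b=nx$ for some integer $n$. The sine is the real sine function (argument in radians). *)

theory Defs
  imports Complex_Main "HOL-Library.Real_Mod"
begin

text \<open>
  Congruence of reals modulo a positive real is the library's \<^const>\<open>rcong\<close>, which is defined by
  equality of remainders. The following lemma shows that it agrees with the usual definition
  by integer multiples of the modulus.
\<close>

lemma rcong_iff_diff_int_multiple:
  fixes a b x :: real
  shows "[a = b] (rmod x) \<longleftrightarrow> (\<exists>n::int. a - b = of_int n * x)"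
  using rcong_altdef[of b a x] by (auto simp: rcong_sym_iff[of b a] algebra_simps)

end

theory Submission
  imports Defs
begin

text \<open>
  In the coordinate \<open>d = a - (2 * m + 1) * pi\<close>, the displacement from the odd multiple of \<open>pi\<close>
  in the middle of the period cell containing \<open>a 0\<close>, the recursion becomes \<open>d \<mapsto> d - sin d\<close>
  with \<open>d 0\<close> in the open interval \<open>(-pi, pi)\<close>; the endpoints are excluded precisely because
  \<open>a 0\<close> is not a multiple of \<open>2 * pi\<close>. On \<open>[0, pi)\<close> the bounds \<open>0 \<le> sin d \<le> d\<close> make the orbit
  decrease without leaving the interval, so it has a limit there. By continuity the sine
  vanishes at that limit, and \<open>0\<close> is the only zero of the sine in \<open>[0, pi)\<close>
  (\<open>sine_descent_tendsto_zero\<close>). The map is odd, so negative displacements reduce to positive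
  ones. Hence \<open>a\<close> tends to \<open>(2 * m + 1) * pi\<close>.
\<close>

text \<open>
  A bounded monotone orbit converges to a fixed point of \<open>x \<mapsto> x - sin x\<close>, that is, to a zero of
  the sine. Starting strictly below \<open>pi\<close> matters: \<open>pi\<close> is itself a fixed point, and the
  limit avoids it because it is at most \<open>d 0\<close>.
\<close>

lemma sine_descent_tendsto_zero:
  fixes d :: "nat \<Rightarrow> real"
  assumes start: "0 \<le> d 0" "d 0 < pi"
    and rec: "\<And>k. d (Suc k) = d k - sin (d k)"
  shows "d \<longlonglongrightarrow> 0"
proof -
  have range: "0 \<le> d k \<and> d k \<le> d 0" for k
  proof (induction k)
    case 0
    show ?case using start by simp
  next
    case (Suc k)
    then have "0 \<le> sin (d k)" "sin (d k) \<le> d k"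
      using start by (auto intro: sin_ge_zero sin_x_le_x)
    with Suc show ?case by (simp add: rec)
  qed
  have "decseq d"
    using range start by (intro decseq_SucI) (fastforce simp: rec intro: sin_ge_zero)
  then obtain l where l: "d \<longlonglongrightarrow> l"
    using decseq_convergent[of d 0] range by blast
  have "0 \<le> l" "l \<le> d 0"
    using range by (auto intro: LIMSEQ_le_const[OF l] LIMSEQ_le_const2[OF l])
  have "(\<lambda>k. d k - sin (d k)) \<longlonglongrightarrow> l - sin l"
    by (intro tendsto_intros l)
  then have "(\<lambda>k. d (Suc k)) \<longlonglongrightarrow> l - sin l"
    by (simp add: rec)
  then have "l - sin l = l"
    using LIMSEQ_Suc[OF l] LIMSEQ_unique by blast
  then have "l = 0"
    using sin_gt_zero[of l] \<open>0 \<le> l\<close> \<open>l \<le> d 0\<close> start by fastforce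
  with l show ?thesis by simp
qed

theorem theorem6:
  fixes a :: "nat \<Rightarrow> real"
  assumes "\<not> [a 0 = 0] (rmod (2 * pi))"
    and "\<And>k. a (Suc k) = a k + sin (a k)"
  shows "convergent a \<and> [lim a = pi] (rmod (2 * pi))"
proof -
  define m where "m = \<lfloor>a 0 / (2 * pi)\<rfloor>"
  define c where "c = of_int m * (2 * pi) + pi"
  define d where "d k = a k - c" for k
  have "of_int m \<le> a 0 / (2 * pi)" "a 0 / (2 * pi) < of_int m + 1"
    unfolding m_def by linarith+
  then have "of_int m * (2 * pi) \<le> a 0" "a 0 < (of_int m + 1) * (2 * pi)"
    by (simp_all add: pos_le_divide_eq pos_divide_less_eq)
  moreover have "a 0 \<noteq> of_int m * (2 * pi)"
    using assms(1) by (auto simp: rcong_iff_diff_int_multiple)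
  ultimately have start: "- pi < d 0" "d 0 < pi"
    by (auto simp: d_def c_def algebra_simps)
  have "sin (a k) = - sin (d k)" for k
  proof -
    have "a k = (d k + pi) + 2 * pi * of_int m"
      by (simp add: d_def c_def)
    then have "sin (a k) = sin (d k + pi)"
      by (simp only: sin_add sin_int_2pin cos_int_2pin mult_1_right mult_zero_right add_0_right)
    then show ?thesis by simp
  qed
  then have rec: "d (Suc k) = d k - sin (d k)" for k
    by (simp add: d_def assms(2))
  have "d \<longlonglongrightarrow> 0"
  proof (cases "0 \<le> d 0")
    case True
    then show ?thesis using start rec by (intro sine_descent_tendsto_zero)
  next
    case False
    then have "(\<lambda>k. - d k) \<longlonglongrightarrow> 0"
      using start rec by (intro sine_descent_tendsto_zero) auto
    then show ?thesis by (simp add: tendsto_minus_cancel_left[of d 0, symmetric])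
  qed
  then have lim: "a \<longlonglongrightarrow> c"
    by (simp add: d_def[abs_def] LIM_zero_iff)
  moreover have "[c = pi] (rmod (2 * pi))"
    by (auto simp: rcong_iff_diff_int_multiple c_def)
  ultimately show ?thesis
    by (auto simp: convergent_def limI)
qed

end
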